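(* Let $d\geq 3$ be an integer and let $S\subseteq \mathbb{Z}_2^d$ with $0\notin S$. If the Cayley graph $(\mathbb{Z}_2^d,S)$ is triangle-free, $K_{2,3}$-free and has diameter $2$, then $(\mathbb{Z}_2^d,S)$ is (isomorphic to) the Clebsch graph, which is an $\mathrm{srg}(16,5,0,2)$.
   Context: For a finite abelian group $A$ (written additively) and an inverse-closed subset $S$ of $A$ (with $0 \notin S$, so that the graph has no loops), the Cayley graph $(A,S)$ has vertex set $A$, and two vertices $x,y\in A$ are adjacent if and only if $x-y\in S$. (In $\mathbb{Z}_2^d$ every subset is inverse-closed.) A graph is $H$-free if it contains no (not necessarily induced) subgraph isomorphic to $H$; triangle-free means $K_3$-free. A graph has diameter $2$ if it is connected and the maximum distance between two of its vertices is exactly $2$. An $\mathrm{srg}(n,k,\lambda,\mu)$ is a $k$-regular graph on $n$ vertices in which every pair of adjacent vertices has exactly $\lambda$ common neighbours and every pair of distinct non-adjacent vertices has exactly $\mu$ common neighbours. The Clebsch graph is the Cayley graph $(\mathbb{Z}_2^4,S_0)$ with $S_0=\{1000,0100,0010,0001,1111\}$; it is the unique $\mathrm{srg}(16,5,0,2)$ up to isomorphism. *)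

theory Defs
  imports
    "HOL-Analysis.Cartesian_Space"
    "HOL-Library.Z2"
    "Graph_Theory.Graph_Theory"
begin

text \<open>
  Undirected simple graphs are rendered as the symmetric, loop-free digraphs without parallel
  arcs of the library (locale \<^locale>\<open>graph\<close>); an edge is a pair of opposite arcs.
  The group \<open>\<int>\<^sub>2\<^sup>d\<close> is the type \<open>bit ^ 'd\<close> with \<open>d = CARD('d)\<close>.
\<close>

definition cayley_graph :: "'a::ab_group_add set \<Rightarrow> ('a, 'a \<times> 'a) pre_digraph" where
  "cayley_graph S = with_proj \<lparr> pverts = UNIV, parcs = {(x, y). x - y \<in> S} \<rparr>"

lemma verts_cayley_graph [simp]: "verts (cayley_graph S) = UNIV"
  by (simp add: cayley_graph_def)

lemma dominates_cayley_graph [simp]: "x \<rightarrow>\<^bsub>cayley_graph S\<^esub> y \<longleftrightarrow> x - y \<in> S"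
  by (simp add: cayley_graph_def)

lemma wf_digraph_cayley_graph: "wf_digraph (cayley_graph S)"
  by unfold_locales simp_all

lemma graph_cayley_graph:
  fixes S :: "'a::ab_group_add set"
  assumes "finite (UNIV :: 'a set)" "0 \<notin> S" "\<And>s. s \<in> S \<Longrightarrow> - s \<in> S"
  shows "graph (cayley_graph S)"
proof -
  let ?P = "\<lparr> pverts = UNIV, parcs = {(x, y). x - y \<in> S} \<rparr> :: 'a pair_pre_digraph"
  have "finite (UNIV :: ('a \<times> 'a) set)"
    using assms(1) by (simp add: finite_prod)
  then have "finite (parcs ?P)"
    using finite_subset subset_UNIV by blast
  moreover have "y - x \<in> S" if "x - y \<in> S" for x y
    using assms(3)[OF that] by simp
  ultimately interpret pair_graph ?P
    using assms(1,2) by unfold_locales (auto simp: symmetric_def intro!: symI)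
  show ?thesis
    unfolding cayley_graph_def by (rule graph_axioms)
qed

text \<open>
  The isomorphism type of the forbidden graph is given by a predicate \<open>P\<close> that
  characterises it up to isomorphism, such as \<^term>\<open>complete_digraph 3\<close>. Since
  \<^const>\<open>subgraph\<close> does not require the subgraph to be induced, neither does this.
\<close>

definition free_of :: "(('a, 'b) pre_digraph \<Rightarrow> bool) \<Rightarrow> ('a, 'b) pre_digraph \<Rightarrow> bool" where
  "free_of P G \<longleftrightarrow> \<not> (\<exists>H. subgraph H G \<and> P H)"

text \<open>
  The library's shortest-path cost, with all arcs of weight 1, is the graph distance.
\<close>

definition graph_dist :: "('a, 'b) pre_digraph \<Rightarrow> 'a \<Rightarrow> 'a \<Rightarrow> ereal" where
  "graph_dist G u v = wf_digraph.\<mu> G (\<lambda>_. 1) u v"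

definition has_diameter :: "('a, 'b) pre_digraph \<Rightarrow> nat \<Rightarrow> bool" where
  "has_diameter G k \<longleftrightarrow> Digraph_Component.connected G \<and>
     (\<forall>u\<in>verts G. \<forall>v\<in>verts G. graph_dist G u v \<le> ereal (real k)) \<and>
     (\<exists>u\<in>verts G. \<exists>v\<in>verts G. graph_dist G u v = ereal (real k))"

definition common_neighbours :: "('a, 'b) pre_digraph \<Rightarrow> 'a \<Rightarrow> 'a \<Rightarrow> 'a set" where
  "common_neighbours G u v = {w \<in> verts G. u \<rightarrow>\<^bsub>G\<^esub> w \<and> v \<rightarrow>\<^bsub>G\<^esub> w}"

definition srg :: "('a, 'b) pre_digraph \<Rightarrow> nat \<Rightarrow> nat \<Rightarrow> nat \<Rightarrow> nat \<Rightarrow> bool" where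
  "srg G n k l m \<longleftrightarrow> graph G \<and> card (verts G) = n \<and>
     (\<forall>v\<in>verts G. out_degree G v = k) \<and>
     (\<forall>u\<in>verts G. \<forall>v\<in>verts G. u \<rightarrow>\<^bsub>G\<^esub> v \<longrightarrow> card (common_neighbours G u v) = l) \<and>
     (\<forall>u\<in>verts G. \<forall>v\<in>verts G. u \<noteq> v \<and> \<not> u \<rightarrow>\<^bsub>G\<^esub> v \<longrightarrow>
        card (common_neighbours G u v) = m)"

definition clebsch_graph :: "(bit ^ 4, (bit ^ 4) \<times> (bit ^ 4)) pre_digraph" where
  "clebsch_graph = cayley_graph
     {vector [1, 0, 0, 0], vector [0, 1, 0, 0], vector [0, 0, 1, 0], vector [0, 0, 0, 1],
      vector [1, 1, 1, 1]}"

end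

theory Submission
  imports Defs
begin

text \<open>
  The hypotheses say that every \<open>a \<noteq> 0\<close> outside \<open>S\<close> is a sum of two elements of \<open>S\<close> in exactly
  two ordered ways, and that no element of \<open>S\<close> is such a sum. With \<open>k = card S\<close>, every nontrivial
  character sum \<open>\<theta>\<close> over \<open>S\<close> then satisfies \<open>(\<theta> + 1)\<^sup>2 = k - 1\<close>, so \<open>k - 1 = m\<^sup>2\<close> and
  \<open>\<theta> + 1 = \<plusminus>m\<close>. Fourier inversion at some \<open>a \<noteq> 0\<close> outside \<open>S\<close> gives that \<open>m\<close> divides
  \<open>k + 1 = m\<^sup>2 + 2\<close>, hence \<open>m\<close> divides 2; this avoids the Ramanujan-Nagell equation
  \<open>(2k + 1)\<^sup>2 + 7 = 2\<^bsup>d+3\<^esup>\<close> that results from counting alone. As \<open>d \<ge> 3\<close>, only \<open>k = 5\<close>, \<open>d = 4\<close>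
  is left. In that case the fifth element of \<open>S\<close> has to be the sum of the other four, which form
  a basis.
\<close>

section \<open>Arithmetic in an elementary abelian 2-group\<close>

lemma bit_vec_add_self [simp]: "x + x = (0 :: bit ^ 'd)"
  by (simp add: vec_eq_iff)

lemma bit_vec_add_self_left [simp]: "x + (x + y) = (y :: bit ^ 'd)"
  by (metis add.assoc add_0 bit_vec_add_self)

lemma bit_vec_diff [simp]: "x - y = (x + y :: bit ^ 'd)"
  by (metis add_diff_cancel_right' bit_vec_add_self_left add.commute)

lemma bit_vec_minus [simp]: "- x = (x :: bit ^ 'd)"
  by (metis add_eq_0_iff bit_vec_add_self)

lemma bit_vec_add_eq_0_iff [simp]: "x + y = 0 \<longleftrightarrow> x = (y :: bit ^ 'd)"
  by (metis add_right_cancel bit_vec_add_self)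

lemma CARD_bit_vec: "CARD(bit ^ 'd) = 2 ^ CARD('d)"
proof -
  have "(UNIV :: bit set) = {0, 1}"
    using bit.exhaust by auto
  then have "CARD(bit) = 2"
    by (metis card_2_iff zero_neq_one)
  then show ?thesis
    by simp
qed

lemma finite_bit_vec [simp]: "finite (A :: (bit ^ 'd) set)"
proof -
  have "finite (UNIV :: (bit ^ 'd) set)"
    by (rule card_ge_0_finite) (simp add: CARD_bit_vec del: CARD_vec)
  then show ?thesis
    by (rule rev_finite_subset) simp
qed

section \<open>Characters and their orthogonality\<close>

text \<open>The character x -> (-1)^(u.x). The group has exponent 2, so all its characters have this
  form and integer values suffice.\<close>

definition char_bit :: "bit ^ 'd \<Rightarrow> bit ^ 'd \<Rightarrow> int" where
  "char_bit u x = (\<Prod>i\<in>UNIV. if u $ i = 1 \<and> x $ i = 1 then -1 else 1)"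

lemma char_bit_commute: "char_bit u x = char_bit x u"
  by (simp add: char_bit_def conj_commute)

lemma char_bit_0 [simp]: "char_bit 0 x = 1"
  by (simp add: char_bit_def)

lemma char_bit_add: "char_bit u (x + y) = char_bit u x * char_bit u y"
  unfolding char_bit_def prod.distrib[symmetric]
proof (rule prod.cong)
  fix i
  show "(if u $ i = 1 \<and> (x + y) $ i = 1 then -1 else 1 :: int) =
    (if u $ i = 1 \<and> x $ i = 1 then -1 else 1) * (if u $ i = 1 \<and> y $ i = 1 then -1 else 1)"
    by (cases "x $ i"; cases "y $ i") auto
qed simp

lemma char_bit_axis: "u $ i = 1 \<Longrightarrow> char_bit u (axis i 1) = -1"
proof -
  assume "u $ i = 1"
  then have "char_bit u (axis i 1) = (\<Prod>j\<in>UNIV. if j = i then -1 else 1)"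
    unfolding char_bit_def by (intro prod.cong) (auto simp: axis_def)
  then show ?thesis
    by simp
qed

text \<open>If \<open>u \<noteq> 0\<close>, translation by a unit vector at a nonzero coordinate of
  \<open>u\<close> reverses the sign of the sum.\<close>

lemma sum_char_bit: "(\<Sum>x\<in>UNIV. char_bit u x) = (if u = 0 then 2 ^ CARD('d) else 0)"
  for u :: "bit ^ 'd"
proof (cases "u = 0")
  case True
  then show ?thesis
    by (simp add: CARD_bit_vec del: CARD_vec)
next
  case False
  then obtain i where i: "u $ i = 1"
    by (auto simp: vec_eq_iff)
  have "(\<Sum>x\<in>UNIV. char_bit u x) = (\<Sum>x\<in>UNIV. char_bit u (x + axis i 1))"
    by (rule sum.reindex_bij_witness[where i = "\<lambda>x. x + axis i 1" and j = "\<lambda>x. x + axis i 1"])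
      (auto simp: add.assoc)
  also have "\<dots> = - (\<Sum>x\<in>UNIV. char_bit u x)"
    by (simp add: char_bit_add char_bit_axis[OF i] sum_negf)
  finally show ?thesis
    using False by simp
qed

lemma sum_char_bit': "(\<Sum>u\<in>UNIV. char_bit u x) = (if x = 0 then 2 ^ CARD('d) else 0)"
  for x :: "bit ^ 'd"
  using sum_char_bit[of x] by (simp add: char_bit_commute)

section \<open>Spectrum of the connection set\<close>

text \<open>In design-theoretic terms, \<open>S\<close> is a partial difference set with \<open>\<lambda> = 0\<close> and \<open>\<mu> = 2\<close>.\<close>

locale bit_pds =
  fixes S :: "(bit ^ 'd) set"
  assumes zero_notin: "0 \<notin> S"
    and sum_free: "x \<in> S \<Longrightarrow> y \<in> S \<Longrightarrow> x + y \<notin> S"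
    and two_sums: "a \<noteq> 0 \<Longrightarrow> a \<notin> S \<Longrightarrow> card {x \<in> S. x + a \<in> S} = 2"
begin

text \<open>The eigenvalue of the adjacency matrix of \<open>cayley_graph S\<close> on the
  eigenvector \<open>char_bit u\<close>.\<close>

definition eigenvalue :: "bit ^ 'd \<Rightarrow> int" where
  "eigenvalue u = (\<Sum>x\<in>S. char_bit u x)"

text \<open>Linear in the indicators of \<open>S\<close> and of 0, so that it can be multiplied by a
  character and summed term by term.\<close>

lemma card_sums:
  "int (card {x \<in> S. x + a \<in> S}) =
    2 - 2 * of_bool (a \<in> S) + (int (card S) - 2) * of_bool (a = 0)"
proof (cases "a = 0 \<or> a \<in> S")
  case True
  then show ?thesis
  proof
    assume "a \<in> S"
    then have "{x \<in> S. x + a \<in> S} = {}"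
      using sum_free by blast
    moreover have "a \<noteq> 0"
      using \<open>a \<in> S\<close> zero_notin by blast
    ultimately show ?thesis
      using \<open>a \<in> S\<close> by (simp only: card.empty) simp
  qed (simp add: zero_notin)
qed (simp add: two_sums)

lemma eigenvalue_0: "eigenvalue 0 = int (card S)"
  by (simp add: eigenvalue_def)

text \<open>Grouping the pairs in the squared sum by their sum \<open>a\<close> brings in
  \<open>card_sums\<close>; by orthogonality its constant 2 contributes only at
  \<open>u = 0\<close>.\<close>

lemma eigenvalue_square:
  "eigenvalue u ^ 2 + 2 * eigenvalue u =
    int (card S) - 2 + (if u = 0 then 2 * 2 ^ CARD('d) else 0)"
proof -
  have "eigenvalue u ^ 2 = (\<Sum>x\<in>S. \<Sum>y\<in>S. char_bit u (x + y))"
    by (simp add: eigenvalue_def power2_eq_square sum_product char_bit_add)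
  also have "\<dots> = (\<Sum>x\<in>S. \<Sum>a\<in>UNIV. of_bool (x + a \<in> S) * char_bit u a)"
  proof (rule sum.cong)
    fix x
    have "(\<Sum>y\<in>S. char_bit u (x + y)) = (\<Sum>a | x + a \<in> S. char_bit u a)"
      by (rule sum.reindex_bij_witness[where i = "\<lambda>y. x + y" and j = "\<lambda>y. x + y"]) auto
    also have "\<dots> = (\<Sum>a\<in>UNIV. if x + a \<in> S then char_bit u a else 0)"
      by (simp add: sum.If_cases)
    also have "\<dots> = (\<Sum>a\<in>UNIV. of_bool (x + a \<in> S) * char_bit u a)"
      by (rule sum.cong) auto
    finally show "(\<Sum>y\<in>S. char_bit u (x + y)) =
        (\<Sum>a\<in>UNIV. of_bool (x + a \<in> S) * char_bit u a)" .
  qed simp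
  also have "\<dots> = (\<Sum>a\<in>UNIV. \<Sum>x\<in>S. of_bool (x + a \<in> S) * char_bit u a)"
    by (rule sum.swap)
  also have "\<dots> = (\<Sum>a\<in>UNIV. int (card {x \<in> S. x + a \<in> S}) * char_bit u a)"
    by (intro sum.cong) (simp_all add: sum_distrib_right[symmetric] Collect_conj_eq)
  also have "\<dots> = (\<Sum>a\<in>UNIV. 2 * char_bit u a - 2 * (of_bool (a \<in> S) * char_bit u a)
      + (int (card S) - 2) * (of_bool (a = 0) * char_bit u a))"
    unfolding card_sums by (simp add: algebra_simps)
  also have "\<dots> = 2 * (\<Sum>a\<in>UNIV. char_bit u a) - 2 * (\<Sum>a\<in>UNIV. of_bool (a \<in> S) * char_bit u a)
      + (int (card S) - 2) * (\<Sum>a\<in>UNIV. of_bool (a = 0) * char_bit u a)"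
    by (simp only: sum.distrib sum_subtractf sum_distrib_left)
  also have "(\<Sum>a\<in>UNIV. of_bool (a \<in> S) * char_bit u a) = eigenvalue u"
    unfolding eigenvalue_def by (intro sum.mono_neutral_cong_right) auto
  also have "(\<Sum>a\<in>UNIV. of_bool (a = 0) * char_bit u a) = (\<Sum>a\<in>{0}. char_bit u a)"
    by (intro sum.mono_neutral_cong_right) auto
  finally show ?thesis
    by (simp add: sum_char_bit char_bit_commute[of u 0])
qed

text \<open>Fourier inversion: after exchanging the sums, orthogonality keeps only
  \<open>x = a\<close>.\<close>

lemma sum_eigenvalue:
  "(\<Sum>u\<in>UNIV. char_bit u a * eigenvalue u) = (if a \<in> S then 2 ^ CARD('d) else 0)"
proof -
  have "(\<Sum>u\<in>UNIV. char_bit u a * eigenvalue u) =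
      (\<Sum>u\<in>UNIV. \<Sum>x\<in>S. char_bit u (a + x))"
    by (simp add: eigenvalue_def sum_distrib_left char_bit_add)
  also have "\<dots> = (\<Sum>x\<in>S. \<Sum>u\<in>UNIV. char_bit u (a + x))"
    by (rule sum.swap)
  also have "\<dots> = (if a \<in> S then 2 ^ CARD('d) else 0)"
    by (simp add: sum_char_bit')
  finally show ?thesis .
qed

lemma card_square: "int (card S) ^ 2 + int (card S) + 2 = 2 * 2 ^ CARD('d)"
  using eigenvalue_square[of 0] by (simp add: eigenvalue_0)

lemma card_cases:
  assumes "CARD('d) \<ge> 3"
  shows "card S = 5 \<and> CARD('d) = 4"
proof -
  define k where "k = int (card S)"
  \<comment> \<open>Any nonzero index would serve: \<open>m\<close> is the common absolute value of
    all nontrivial shifted eigenvalues.\<close>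
  define m where "m = \<bar>eigenvalue 1 + 1\<bar>"
  have ge: "(8 :: int) \<le> 2 ^ CARD('d)"
    using power_increasing[OF assms, of "2 :: int"] by simp
  have k: "k ^ 2 + k + 2 = 2 * 2 ^ CARD('d)"
    unfolding k_def by (rule card_square)
  have shifted: "(eigenvalue u + 1) ^ 2 = k - 1" if "u \<noteq> 0" for u
    using eigenvalue_square[of u] that by (simp add: k_def power2_eq_square algebra_simps)
  have m: "m ^ 2 = k - 1"
    unfolding m_def by (simp add: shifted vec_eq_iff)
  have dvd: "m dvd eigenvalue u + 1" if "u \<noteq> 0" for u
  proof -
    have "(eigenvalue u + 1) ^ 2 = m ^ 2"
      by (simp add: shifted[OF that] m)
    then show ?thesis
      by (auto simp: power2_eq_iff)
  qed
  \<comment> \<open>Otherwise \<open>S\<close> is the set of all nonzero vectors, and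
    \<open>card_square\<close> leaves only \<open>k = 0\<close> or \<open>k = 1\<close>.\<close>
  obtain a where a: "a \<noteq> 0" "a \<notin> S"
  proof (rule ccontr)
    assume "\<not> thesis"
    then have "S = UNIV - {0}"
      using that zero_notin by blast
    then have "card S = 2 ^ CARD('d) - 1"
      by (simp add: card_Diff_singleton CARD_bit_vec del: CARD_vec)
    then have "k = 2 ^ CARD('d) - 1"
      by (simp add: k_def of_nat_diff)
    then have "2 ^ CARD('d) = k + 1"
      by simp
    with k have "k * (k - 1) = 0"
      by (simp add: power2_eq_square algebra_simps)
    then have "k = 0 \<or> k = 1"
      by simp
    with \<open>k = 2 ^ CARD('d) - 1\<close> ge show False
      by linarith
  qed
  \<comment> \<open>The term of \<open>u = 0\<close>, which is \<open>k + 1\<close>, is split off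
    because \<open>dvd\<close> covers only the others.\<close>
  define T where "T = (\<Sum>u\<in>UNIV - {0}. char_bit u a * (eigenvalue u + 1))"
  have "(\<Sum>u\<in>UNIV. char_bit u a * (eigenvalue u + 1)) = 0"
    using a by (simp add: distrib_left sum.distrib sum_eigenvalue sum_char_bit')
  moreover have "(\<Sum>u\<in>UNIV. char_bit u a * (eigenvalue u + 1)) = (k + 1) + T"
    by (subst sum.remove[of _ 0]) (simp_all add: eigenvalue_0 k_def T_def)
  ultimately have "k + 1 = - T"
    by simp
  moreover have "m dvd T"
    unfolding T_def by (intro dvd_sum dvd_mult dvd) simp
  ultimately have "m dvd k + 1"
    by simp
  also have "k + 1 = m ^ 2 + 2"
    using m by simp
  finally have "m dvd 2"
    by (simp add: power2_eq_square dvd_add_right_iff)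
  moreover have "m \<ge> 0"
    by (simp add: m_def)
  ultimately have "m = 1 \<or> m = 2"
    using zdvd_imp_le[of m 2] by (cases "m = 0") auto
  then have "k = 2 \<or> k = 5"
    using m by auto
  \<comment> \<open>For \<open>k = 2\<close> the counting identity gives a group of order 4, against
    \<open>ge\<close>.\<close>
  then have k5: "k = 5"
    using k ge by auto
  with k have "(2 :: int) ^ CARD('d) = 2 ^ 4"
    by simp
  then have "CARD('d) = 4"
    by (subst (asm) power_inject_exp) auto
  with k5 show ?thesis
    by (simp add: k_def)
qed

section \<open>The five-element case\<close>

text \<open>The sum of \<open>a\<close>, \<open>b\<close>, \<open>c\<close> is neither 0 nor in
  \<open>S\<close>, so it splits into two elements of \<open>S\<close>. Neither can be one of the
  three, which leaves \<open>d\<close> and \<open>e\<close>.\<close>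

lemma sum_of_all_five:
  assumes S: "S = {a, b, c, d, e}" and dist: "distinct [a, b, c, d, e]"
  shows "e = a + b + c + d"
proof -
  define w where "w = a + b + c"
  have sums: "x + y \<notin> S" if "x \<in> {a, b, c, d, e}" "y \<in> {a, b, c, d, e}" for x y
    using sum_free that S by blast
  have w0: "w \<noteq> 0"
    using sums[of a b] S by (auto simp: w_def)
  \<comment> \<open>Otherwise \<open>p\<close>, \<open>q\<close> and \<open>r\<close> would all be
    first summands of \<open>p + q\<close>, one more than \<open>two_sums\<close> allows.\<close>
  have pair: "p + q \<noteq> r + s"
    if "{p, q, r, s} \<subseteq> S" "distinct [p, q, r, s]" for p q r s
  proof
    assume eq: "p + q = r + s"
    have "p + q \<noteq> 0" "p + q \<notin> S"
      using that sum_free by auto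
    then have "card {x \<in> S. x + (p + q) \<in> S} = 2"
      by (rule two_sums)
    moreover have "r + (p + q) = s"
      by (simp add: eq)
    then have "{p, q, r} \<subseteq> {x \<in> S. x + (p + q) \<in> S}"
      using that by (auto simp: add.left_commute)
    then have "card {p, q, r} \<le> card {x \<in> S. x + (p + q) \<in> S}"
      by (rule card_mono[rotated]) simp
    ultimately show False
      using that by simp
  qed
  have "w \<notin> S"
  proof
    assume "w \<in> S"
    then consider "w = a" | "w = b" | "w = c" | "w = d" | "w = e"
      using S by blast
    then show False
    proof cases
      case 4
      then have "a + b = c + d" unfolding w_def by (metis add.commute bit_vec_add_self_left)
      then show False using pair[of a b c d] S dist by auto
    next
      case 5
      then have "a + b = c + e" unfolding w_def by (metis add.commute bit_vec_add_self_left)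
      then show False using pair[of a b c e] S dist by auto
    qed (use dist in \<open>auto simp: w_def add.assoc add.left_commute\<close>)
  qed
  with w0 have "card {x \<in> S. x + w \<in> S} = 2"
    by (rule two_sums)
  then obtain x where x: "x \<in> S" "x + w \<in> S"
    by (metis (mono_tags, lifting) card.empty empty_Collect_eq zero_neq_numeral)
  \<comment> \<open>Adding \<open>z\<close> cancels it from \<open>w\<close> and leaves a sum of two
    elements of \<open>S\<close>.\<close>
  have *: "z + w \<notin> S" if "z \<in> {a, b, c}" for z
    using that sums[of b c] sums[of a c] sums[of a b]
    by (auto simp: w_def add.assoc add.left_commute add.commute)
  have "x + w \<notin> {a, b, c}"
    using *[of "x + w"] x by (auto simp: add.assoc)
  moreover have "x \<notin> {a, b, c}"
    using * x by blast
  moreover have "x + w \<noteq> x"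
    using w0 by simp
  ultimately have "w = d + e"
    using x S by (metis add.commute bit_vec_add_self_left insertE singletonD insertCI)
  then show ?thesis
    unfolding w_def by (metis add.commute bit_vec_add_self_left)
qed

text \<open>Translation by \<open>u\<close> matches the common neighbours of \<open>u\<close> and
  \<open>v\<close> with the ordered ways to write \<open>u + v\<close> as a sum of two elements of
  \<open>S\<close>.\<close>

lemma srg_cayley_graph: "srg (cayley_graph S) (2 ^ CARD('d)) (card S) 0 2"
proof -
  have "graph (cayley_graph S)"
    by (rule graph_cayley_graph) (simp_all add: zero_notin)
  moreover have "out_degree (cayley_graph S) v = card S" for v
  proof -
    have "out_arcs (cayley_graph S) v = (\<lambda>s. (v, v + s)) ` S"
      by (auto simp: cayley_graph_def image_iff) (metis bit_vec_add_self_left)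
    then show ?thesis
      by (simp add: out_degree_def card_image inj_on_def)
  qed
  moreover have "card (common_neighbours (cayley_graph S) u v) = card {s \<in> S. s + (u + v) \<in> S}"
    for u v
    by (rule bij_betw_same_card[where f = "(+) u"], rule bij_betwI[where g = "(+) u"])
      (auto simp: common_neighbours_def ac_simps)
  moreover have "{s \<in> S. s + (u + v) \<in> S} = {}" if "u + v \<in> S" for u v
    using that sum_free by blast
  ultimately show ?thesis
    by (simp add: srg_def CARD_bit_vec two_sums del: CARD_vec)
qed

end

section \<open>The Clebsch graph and the isomorphism onto it\<close>

text \<open>Adjacency depends only on differences, so a group isomorphism carries the graph along
  with its connection set.\<close>

lemma cayley_graph_iso:
  assumes "bij h" and diff: "\<And>x y. h (x - y) = h x - h y"
  shows "digraph_iso (cayley_graph S) (cayley_graph (h ` S))"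
proof -
  have inj: "inj h" and surj: "surj h"
    using \<open>bij h\<close> by (auto simp: bij_def)
  let ?f = "\<lparr> iso_verts = h, iso_arcs = map_prod h h, iso_head = snd, iso_tail = fst \<rparr>"
  have "pre_digraph.digraph_isomorphism (cayley_graph S) ?f"
    using inj wf_digraph_cayley_graph[of S]
    by (auto simp: pre_digraph.digraph_isomorphism_def cayley_graph_def inj_on_def)
  moreover have "map_prod h h ` {(x, y). x - y \<in> S} = {(x, y). x - y \<in> h ` S}"
  proof (intro equalityI subsetI)
    fix p assume "p \<in> {(x, y). x - y \<in> h ` S}"
    moreover obtain x y where "p = (h x, h y)"
      by (metis surj surjD surj_pair)
    ultimately show "p \<in> map_prod h h ` {(x, y). x - y \<in> S}"
      using inj by (auto simp: diff[symmetric] inj_image_mem_iff)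
  qed (auto simp: diff[symmetric])
  then have "cayley_graph (h ` S) = app_iso ?f (cayley_graph S)"
    using surj by (simp add: app_iso_def cayley_graph_def with_proj_def)
  ultimately show ?thesis
    by (auto simp: digraph_iso_def)
qed

definition clebsch_set :: "(bit ^ 4) set" where
  "clebsch_set = {vector [1, 0, 0, 0], vector [0, 1, 0, 0], vector [0, 0, 1, 0],
     vector [0, 0, 0, 1], vector [1, 1, 1, 1]}"

lemma clebsch_graph_eq: "clebsch_graph = cayley_graph clebsch_set"
  by (simp add: clebsch_graph_def clebsch_set_def)

text \<open>The coordinate form reduces questions of membership to cases on four bits.\<close>

lemma mem_clebsch_set:
  "v \<in> clebsch_set \<longleftrightarrow>
    (v $ 1, v $ 2, v $ 3, v $ 4) \<in>
      {(1, 0, 0, 0), (0, 1, 0, 0), (0, 0, 1, 0), (0, 0, 0, 1), (1, 1, 1, 1)}"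
  by (simp add: clebsch_set_def vec_eq_iff forall_4 vector_def)

lemma card_clebsch_set: "card clebsch_set = 5"
  by (simp add: clebsch_set_def vec_eq_iff forall_4 vector_def)

interpretation clebsch: bit_pds clebsch_set
proof
  show "0 \<notin> clebsch_set"
    by (simp add: mem_clebsch_set)
  show "x + y \<notin> clebsch_set" if "x \<in> clebsch_set" "y \<in> clebsch_set" for x y
    using that unfolding mem_clebsch_set by auto
  fix a :: "bit ^ 4"
  assume "a \<noteq> 0" "a \<notin> clebsch_set"
  have "card {x \<in> clebsch_set. x + a \<in> clebsch_set} =
      (\<Sum>x\<in>clebsch_set. of_bool (x + a \<in> clebsch_set))"
    by (simp add: Collect_conj_eq)
  also have "\<dots> = of_bool (vector [1, 0, 0, 0] + a \<in> clebsch_set) +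
      of_bool (vector [0, 1, 0, 0] + a \<in> clebsch_set) +
      of_bool (vector [0, 0, 1, 0] + a \<in> clebsch_set) +
      of_bool (vector [0, 0, 0, 1] + a \<in> clebsch_set) +
      of_bool (vector [1, 1, 1, 1] + a \<in> clebsch_set)"
    \<comment> \<open>Only the index set of the sum is expanded; the membership tests stay folded
      for \<open>mem_clebsch_set\<close>.\<close>
    unfolding clebsch_set_def[THEN arg_cong, of "sum _"]
    by (subst sum.insert; simp add: vec_eq_iff forall_4 vector_def)+
  also have "\<dots> = 2"
    using \<open>a \<noteq> 0\<close> \<open>a \<notin> clebsch_set\<close> unfolding mem_clebsch_set
    by (cases "a $ 1"; cases "a $ 2"; cases "a $ 3"; cases "a $ 4")
      (simp_all add: vec_eq_iff forall_4 vector_def)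
  finally show "card {x \<in> clebsch_set. x + a \<in> clebsch_set} = 2" .
qed

lemma srg_clebsch_graph: "srg clebsch_graph 16 5 0 2"
  using clebsch.srg_cayley_graph by (simp add: clebsch_graph_eq card_clebsch_set)

context bit_pds
begin

text \<open>The linear map \<open>h\<close> sends the unit vectors to \<open>a\<close>,
  \<open>b\<close>, \<open>c\<close>, \<open>d\<close>, and hence 1111 to \<open>e\<close> by
  \<open>sum_of_all_five\<close>. It is injective, and bijective by counting.\<close>

lemma iso_clebsch_graph:
  assumes "CARD('d) \<ge> 3"
  shows "digraph_iso (cayley_graph S) clebsch_graph"
proof -
  have card: "card S = 5" "CARD('d) = 4"
    using card_cases[OF assms] by auto
  obtain a b c d e where S: "S = {a, b, c, d, e}" and dist: "distinct [a, b, c, d, e]"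
  proof -
    obtain xs where "set xs = S" "distinct xs"
      using finite_distinct_list[of S] by auto
    moreover from this have "length xs = 5"
      using card(1) distinct_card by metis
    ultimately show thesis
      using that by (auto simp: numeral_eq_Suc length_Suc_conv)
  qed
  have e: "e = a + b + c + d"
    using S dist by (rule sum_of_all_five)
  define h :: "bit ^ 4 \<Rightarrow> bit ^ 'd" where
    "h v = v $ 1 *s a + v $ 2 *s b + v $ 3 *s c + v $ 4 *s d" for v
  have add: "h (u + v) = h u + h v" for u v
    by (simp add: h_def vector_sadd_rdistrib ac_simps del: add_bit_eq_xor)
  have "v = 0" if "h v = 0" for v
  proof -
    \<comment> \<open>Independence: single elements and the full sum \<open>e\<close> are nonzero as
      members of \<open>S\<close>, sums of two by distinctness, sums of three by
      \<open>sum_free\<close>.\<close>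
    have "0 \<notin> S" "a + b \<notin> S" "a + c \<notin> S" "b + c \<notin> S"
      using zero_notin sum_free S by auto
    then have "0 \<notin> {a, b, c, d}" "a + b + c + d \<noteq> 0"
      "a + b \<noteq> c" "a + b \<noteq> d" "a + c \<noteq> d" "b + c \<noteq> d"
      using S e by auto
    then have "v $ 1 = 0 \<and> v $ 2 = 0 \<and> v $ 3 = 0 \<and> v $ 4 = 0"
      using that dist
      by (cases "v $ 1"; cases "v $ 2"; cases "v $ 3"; cases "v $ 4") (simp_all add: h_def)
    then show ?thesis
      by (simp add: vec_eq_iff forall_4)
  qed
  then have "inj h"
    using add by (metis bit_vec_add_eq_0_iff injI)
  moreover have "card (range h) = CARD(bit ^ 'd)"
    using \<open>inj h\<close> card(2) by (simp add: card_image CARD_bit_vec del: CARD_vec)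
  then have "range h = UNIV"
    by (intro card_subset_eq) simp_all
  ultimately have "bij h"
    by (simp add: bij_def)
  moreover have "h ` clebsch_set = S"
    unfolding clebsch_set_def S by (simp add: h_def vector_def e)
  ultimately have "digraph_iso clebsch_graph (cayley_graph S)"
    using cayley_graph_iso[of h clebsch_set] add by (simp add: clebsch_graph_eq)
  then show ?thesis
    unfolding clebsch_graph_eq by (rule digraph_iso_swap[OF wf_digraph_cayley_graph])
qed

end

section \<open>From the graph hypotheses to conditions on sums\<close>

text \<open>If \<open>s + t\<close> were in \<open>S\<close>, then 0, \<open>s\<close> and
  \<open>t\<close> would form a triangle.\<close>

lemma free_of_K3_sum_free:
  fixes S :: "(bit ^ 'd) set"
  assumes "0 \<notin> S" "free_of (complete_digraph 3) (cayley_graph S)" "s \<in> S" "t \<in> S"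
  shows "s + t \<notin> S"
proof
  assume st: "s + t \<in> S"
  let ?V = "{0, s, t}"
  let ?H = "\<lparr> pverts = ?V, parcs = {(u, v). (u, v) \<in> ?V \<times> ?V \<and> u \<noteq> v} \<rparr>"
  have "0 \<noteq> s" "0 \<noteq> t" "s \<noteq> t"
    using assms st by auto
  then have K: "complete_digraph 3 (with_proj ?H)"
    unfolding complete_digraph_pair_def by simp
  have "arcs (with_proj ?H) \<subseteq> arcs (cayley_graph S)"
    using assms st by (auto simp: cayley_graph_def add.commute)
  then have "subgraph (with_proj ?H) (cayley_graph S)"
    using wf_digraph_cayley_graph[of S]
    by (auto simp: subgraph_def compatible_def cayley_graph_def wf_digraph_def)
  with K assms show False
    by (auto simp: free_of_def)
qed

text \<open>Each counted \<open>x\<close> is a common neighbour of 0 and \<open>a\<close>; three of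
  them would complete a forbidden subgraph.\<close>

lemma free_of_K23_card_le:
  fixes S :: "(bit ^ 'd) set"
  assumes "0 \<notin> S" "free_of (complete_bipartite_digraph 2 3) (cayley_graph S)" "a \<noteq> 0"
  shows "card {x \<in> S. x + a \<in> S} \<le> 2"
proof (rule ccontr)
  assume "\<not> ?thesis"
  then obtain V where V: "V \<subseteq> {x \<in> S. x + a \<in> S}" "card V = 3"
    using obtain_subset_with_card_n[of 3 "{x \<in> S. x + a \<in> S}"] by auto
  let ?U = "{0, a}"
  let ?H = "\<lparr> pverts = ?U \<union> V, parcs = ?U \<times> V \<union> V \<times> ?U \<rparr>"
  \<comment> \<open>If \<open>a\<close> were in \<open>V\<close>, then \<open>a + a = 0\<close>
    would be in \<open>S\<close>.\<close>
  have "?U \<inter> V = {}"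
    using V \<open>0 \<notin> S\<close> by auto
  then have K: "complete_bipartite_digraph 2 3 (with_proj ?H)"
    unfolding complete_bipartite_digraph_pair_def using V \<open>a \<noteq> 0\<close>
    by (intro conjI exI[of _ ?U] exI[of _ V]) auto
  have "arcs (with_proj ?H) \<subseteq> arcs (cayley_graph S)"
    using V by (auto simp: cayley_graph_def add.commute)
  then have "subgraph (with_proj ?H) (cayley_graph S)"
    using wf_digraph_cayley_graph[of S]
    by (auto simp: subgraph_def compatible_def cayley_graph_def wf_digraph_def)
  with K assms show False
    by (auto simp: free_of_def)
qed

lemma graph_dist_le_2D:
  fixes S :: "(bit ^ 'd) set"
  assumes "graph_dist (cayley_graph S) 0 a \<le> 2" "a \<noteq> 0" "a \<notin> S"
  shows "\<exists>x\<in>S. x + a \<in> S"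
proof -
  interpret wf_digraph "cayley_graph S"
    by (rule wf_digraph_cayley_graph)
  \<comment> \<open>A strict bound on the infimum is witnessed by an actual walk, whose length is
    then at most 2.\<close>
  have "\<mu> (\<lambda>_. 1) 0 a < 3"
    using assms(1) unfolding graph_dist_def by (rule le_less_trans) simp
  then obtain p where p: "awalk 0 p a" "awalk_cost (\<lambda>_. 1) p < 3"
    by (auto simp: \<mu>_def INF_less_iff)
  then have "length p < 3"
    by (simp add: awalk_cost_def sum_list_triv)
  then consider "p = []" | s where "p = [s]" | s t where "p = [s, t]"
    by (auto simp: numeral_3_eq_3 less_Suc_eq length_Suc_conv)
  then show ?thesis
    using p(1) assms(2,3)
    by cases (auto simp: pre_digraph.awalk_def pre_digraph.cas.simps cayley_graph_def)
qed

theorem theorem8: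
  fixes S :: "(bit ^ 'd) set"
  assumes "CARD('d) \<ge> 3"
    and "0 \<notin> S"
    and "free_of (complete_digraph 3) (cayley_graph S)"
    and "free_of (complete_bipartite_digraph 2 3) (cayley_graph S)"
    and "has_diameter (cayley_graph S) 2"
  shows "digraph_iso (cayley_graph S) clebsch_graph \<and> srg clebsch_graph 16 5 0 2"
proof -
  interpret bit_pds S
  proof
    show "x + y \<notin> S" if "x \<in> S" "y \<in> S" for x y
      using assms(2,3) that by (rule free_of_K3_sum_free)
    fix a assume a: "a \<noteq> 0" "a \<notin> S"
    let ?A = "{x \<in> S. x + a \<in> S}"
    have "graph_dist (cayley_graph S) 0 a \<le> 2"
      using assms(5) by (simp add: has_diameter_def)
    then obtain x where "x \<in> S" "x + a \<in> S"
      using graph_dist_le_2D a by blast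
    \<comment> \<open>Swapping the two summands gives a second solution, distinct from the first
      because \<open>a \<noteq> 0\<close>.\<close>
    then have "{x, x + a} \<subseteq> ?A"
      by (auto simp: add.assoc)
    then have "card {x, x + a} \<le> card ?A"
      by (intro card_mono) simp_all
    moreover have "card {x, x + a} = 2"
      using a by simp
    moreover have "card ?A \<le> 2"
      using assms(2,4) a(1) by (rule free_of_K23_card_le)
    ultimately show "card ?A = 2"
      by simp
  qed (fact assms(2))
  show ?thesis
    using iso_clebsch_graph[OF assms(1)] srg_clebsch_graph by blast
qed

end
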